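(* For every constant $c>0$ there exist a constant $c'>0$ and $n_0$, depending only on $c$, such that for every $n\ge n_0$ the following holds: if $P$ is a set of $n$ points and $L$ is a set of $n$ lines in $\mathbb{R}^2$ with $I(P,L)\ge c\,n^{4/3}$, then there are at least $c'n$ points of $P$ each lying on at least $c'n^{1/3}$ lines of $L$, and there are at least $c'n$ lines of $L$ each containing at least $c'n^{1/3}$ points of $P$.
   Context: For a finite set of points $P$ and a finite set of lines $L$ in $\mathbb{R}^2$, $I(P,L)$ denotes the number of incidences, i.e. pairs $(p,\ell)\in P\times L$ with $p\in\ell$. *)

theory Defs
  imports "HOL-Analysis.Analysis"
begin

definition is_line :: "(real ^ 2) set \<Rightarrow> bool" where
  "is_line l \<longleftrightarrow> affine l \<and> aff_dim l = 1"

definition incidences :: "(real ^ 2) set \<Rightarrow> (real ^ 2) set set \<Rightarrow> nat" where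
  "incidences P L = card {(p, l). p \<in> P \<and> l \<in> L \<and> p \<in> l}"

end

theory Submission
  imports Defs
begin

text \<open>
  Szemeredi--Trotter bounds the incidences of few points with the lines (or of the points with few
  lines), while the poor points (or lines) contribute at most \<open>c' * n powr (4/3)\<close>; so few rich ones cannot
  account for \<open>c * n powr (4/3)\<close> incidences.

  The Szemeredi--Trotter bound follows Szekely: join consecutive points on each line by a segment.
  Two lines cross at most once, so there are few crossings, and sampling the points turns the linear
  edge bound for crossing-free drawings into the crossing lemma. For straight segments the linear bound
  needs no Euler formula: sort the edges leaving a vertex to the right by slope; the wedge between two
  neighbouring ones is charged to the leftmost vertex in it, and each vertex is charged at most twice.
\<close>

subsection \<open>Straight-line drawings without crossings\<close>

text \<open>
  Points are abstract, with coordinate functions; this lets us shear the plane so that no two points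
  share an \<open>X\<close>-coordinate without moving any point or line.
\<close>

locale plane_coords =
  fixes X Y :: "'a \<Rightarrow> real"
begin

definition slope :: "'a \<times> 'a \<Rightarrow> real" where
  "slope e = (Y (snd e) - Y (fst e)) / (X (snd e) - X (fst e))"

text \<open>This is the height of the whole supporting line, so edges can also be compared outside
  their own range.\<close>

definition height :: "'a \<times> 'a \<Rightarrow> real \<Rightarrow> real" where
  "height e x = Y (fst e) + slope e * (x - X (fst e))"

definition crossing :: "'a \<times> 'a \<Rightarrow> 'a \<times> 'a \<Rightarrow> bool" where
  "crossing e f \<longleftrightarrow> {fst e, snd e} \<inter> {fst f, snd f} = {} \<and>
    (\<exists>x. X (fst e) \<le> x \<and> x \<le> X (snd e) \<and> X (fst f) \<le> x \<and> x \<le> X (snd f) \<and>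
         height e x = height f x)"

text \<open>Ordered pairs: each crossing is counted twice.\<close>

definition crossings :: "('a \<times> 'a) set \<Rightarrow> (('a \<times> 'a) \<times> ('a \<times> 'a)) set" where
  "crossings F = {(e, f). e \<in> F \<and> f \<in> F \<and> crossing e f}"

lemma height_fst [simp]: "height e (X (fst e)) = Y (fst e)"
  by (simp add: height_def)

lemma height_snd: "X (fst e) \<noteq> X (snd e) \<Longrightarrow> height e (X (snd e)) = Y (snd e)"
  by (simp add: height_def slope_def)

lemma height_diff: "height e x = height e z + slope e * (x - z)"
  by (simp add: height_def algebra_simps)

lemma height_eq_imp_height_eq:
  assumes "height e x = height f x" "height e z = height f z" "x \<noteq> z"
  shows "height e t = height f t"
proof -
  have "(slope e - slope f) * (z - x) = 0"
    using assms height_diff[of e z x] height_diff[of f z x] by (simp add: algebra_simps)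
  then have "slope e = slope f" using assms by simp
  then show ?thesis using assms(1) height_diff[of e t x] height_diff[of f t x] by simp
qed

lemma heights_meet_between:
  assumes "x < z" "height e x < height f x" "height f z < height e z"
  obtains t where "x < t" "t < z" "height e t = height f t"
proof -
  define D where "D = (\<lambda>t. height e t - height f t)"
  have "continuous_on {x..z} D" unfolding D_def height_def by (intro continuous_intros)
  then obtain t where t: "x \<le> t" "t \<le> z" "D t = 0"
    using IVT'[of D x 0 z] assms by (auto simp: D_def)
  then have "t \<noteq> x" "t \<noteq> z" using assms by (auto simp: D_def)
  with t that[of t] show thesis by (auto simp: D_def)
qed

end

text \<open>Edges are oriented from left to right, so each is the graph of an affine function over
  an interval. \<open>vertex_off_edge\<close> also excludes overlapping edges with a common left or
  right end.\<close>

locale drawing = plane_coords X Y for X Y :: "'a \<Rightarrow> real" +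
  fixes V :: "'a set" and F :: "('a \<times> 'a) set"
  assumes finite_V: "finite V"
    and inj_X: "inj_on X V"
    and F_subset: "F \<subseteq> V \<times> V"
    and left_right: "e \<in> F \<Longrightarrow> X (fst e) < X (snd e)"
    and vertex_off_edge: "\<lbrakk>e \<in> F; v \<in> V; X (fst e) < X v; X v < X (snd e)\<rbrakk> \<Longrightarrow> Y v \<noteq> height e (X v)"
begin

lemma finite_F: "finite F"
  using F_subset finite_V finite_subset by blast

lemma fst_in: "e \<in> F \<Longrightarrow> fst e \<in> V" and snd_in: "e \<in> F \<Longrightarrow> snd e \<in> V"
  using F_subset by auto

lemma X_eqD: "\<lbrakk>X u = X v; u \<in> V; v \<in> V\<rbrakk> \<Longrightarrow> u = v"
  using inj_X by (auto dest: inj_onD)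

lemma height_right: "e \<in> F \<Longrightarrow> height e (X (snd e)) = Y (snd e)"
  using left_right height_snd by (metis less_irrefl)

text \<open>Agreement at two abscissas puts both edges on one line; were they different, the nearer
  right end would lie inside the longer edge.\<close>

lemma same_left_same_height:
  assumes "e \<in> F" "f \<in> F" "fst e = fst f" "height e x = height f x" "x \<noteq> X (fst e)"
  shows "e = f"
proof -
  have all: "height e t = height f t" for t
    using height_eq_imp_height_eq[OF assms(4) _ assms(5)] assms(3) by (metis height_fst)
  have "snd e = snd f"
    using all height_right[of e] height_right[of f] assms(1-3) left_right[of e] left_right[of f]
      vertex_off_edge[of e "snd f"] vertex_off_edge[of f "snd e"] snd_in X_eqD
    by (metis linorder_neqE_linordered_idom)
  then show ?thesis using assms(3) by (simp add: prod_eq_iff)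
qed

lemma same_right_same_height:
  assumes "e \<in> F" "f \<in> F" "snd e = snd f" "height e x = height f x" "x \<noteq> X (snd e)"
  shows "e = f"
proof -
  have all: "height e t = height f t" for t
    using height_eq_imp_height_eq[OF assms(4) _ assms(5)] assms(1-3) height_right by metis
  have "fst e = fst f"
    using all height_fst[of e] height_fst[of f] assms(1-3) left_right[of e] left_right[of f]
      vertex_off_edge[of e "fst f"] vertex_off_edge[of f "fst e"] fst_in X_eqD
    by (metis linorder_neqE_linordered_idom)
  then show ?thesis using assms(3) by (simp add: prod_eq_iff)
qed

end

locale plane_drawing = drawing +
  assumes no_crossing: "\<lbrakk>e \<in> F; f \<in> F\<rbrakk> \<Longrightarrow> \<not> crossing e f"
begin

text \<open>Without crossings the two edges share an endpoint. If it is the left end of both or the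
  right end of both, a second meeting would make them equal; if one edge ends where the other
  starts, their ranges have only that abscissa in common.\<close>

lemma meet_at_vertex:
  assumes e: "e \<in> F" and f: "f \<in> F" and "e \<noteq> f"
    and x: "X (fst e) \<le> x" "x \<le> X (snd e)" "X (fst f) \<le> x" "x \<le> X (snd f)"
    and eq: "height e x = height f x"
  obtains v where "v \<in> {fst e, snd e} \<inter> {fst f, snd f}" "X v = x"
proof -
  have "{fst e, snd e} \<inter> {fst f, snd f} \<noteq> {}"
    using no_crossing[OF e f] x eq unfolding crossing_def by blast
  then consider "fst e = fst f" | "snd e = snd f" | "fst e = snd f" | "snd e = fst f" by auto
  then show thesis
  proof cases
    case 1
    then show thesis using same_left_same_height[OF e f _ eq] assms(3) that[of "fst e"] by auto
  next
    case 2
    then show thesis using same_right_same_height[OF e f _ eq] assms(3) that[of "snd e"] by auto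
  next
    case 3
    then show thesis using that[of "fst e"] x by auto
  next
    case 4
    then show thesis using that[of "snd e"] x by auto
  qed
qed

text \<open>A change of order would force a meeting strictly between \<open>x\<close> and
  \<open>z\<close>, hence at a shared endpoint, but neither edge has an end there. A meeting at
  \<open>x\<close> itself can only be at the left ends.\<close>

lemma order_leftwards:
  assumes e: "e \<in> F" and f: "f \<in> F"
    and x: "X (fst e) \<le> x" "X (fst f) \<le> x" "x < z" "z \<le> X (snd e)" "z \<le> X (snd f)"
    and less: "height e z < height f z"
  shows "height e x \<le> height f x" and "height e x = height f x \<Longrightarrow> fst e = fst f"
proof -
  have ne: "e \<noteq> f" using less by auto
  show "height e x \<le> height f x"
  proof (rule ccontr)
    assume "\<not> ?thesis"
    then obtain t where t: "x < t" "t < z" "height f t = height e t"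
      using heights_meet_between[of x z f e] x(3) less by auto
    obtain v where "v \<in> {fst e, snd e} \<inter> {fst f, snd f}" "X v = t"
      using meet_at_vertex[OF e f ne, of t] t x by fastforce
    then show False using t x by auto
  qed
  assume "height e x = height f x"
  then obtain v where "v \<in> {fst e, snd e} \<inter> {fst f, snd f}" "X v = x"
    using meet_at_vertex[OF e f ne, of x] x by auto
  then show "fst e = fst f" using x by auto
qed

section \<open>Wedges, their apexes and the linear edge bound\<close>

definition steeper :: "'a \<times> 'a \<Rightarrow> ('a \<times> 'a) set" where
  "steeper e = {f \<in> F. fst f = fst e \<and> slope e < slope f}"

definition next_above :: "'a \<times> 'a \<Rightarrow> 'a \<times> 'a" where
  "next_above e = arg_min_on slope (steeper e)"

text \<open>The vertices in the triangle between \<open>e\<close> and its upper neighbour, cut off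
  at the nearer right end and without the common left end. Meaningful only if
  \<open>steeper e\<close> is nonempty.\<close>

definition wedge :: "'a \<times> 'a \<Rightarrow> 'a set" where
  "wedge e = {v \<in> V. X (fst e) < X v \<and> X v \<le> X (snd e) \<and> X v \<le> X (snd (next_above e)) \<and>
     height e (X v) \<le> Y v \<and> Y v \<le> height (next_above e) (X v)}"

definition apex :: "'a \<times> 'a \<Rightarrow> 'a" where
  "apex e = arg_min_on X (wedge e)"

lemma finite_steeper: "finite (steeper e)"
  using finite_F by (simp add: steeper_def)

lemma next_above:
  assumes "steeper e \<noteq> {}"
  shows "next_above e \<in> F" "fst (next_above e) = fst e" "slope e < slope (next_above e)"
    and "\<And>f. \<lbrakk>f \<in> F; fst f = fst e; slope e < slope f\<rbrakk> \<Longrightarrow> slope (next_above e) \<le> slope f"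
proof -
  have "next_above e \<in> steeper e"
    unfolding next_above_def using arg_min_if_finite(1)[OF finite_steeper assms] .
  then show "next_above e \<in> F" "fst (next_above e) = fst e" "slope e < slope (next_above e)"
    by (auto simp: steeper_def)
  fix f assume "f \<in> F" "fst f = fst e" "slope e < slope f"
  then show "slope (next_above e) \<le> slope f"
    unfolding next_above_def
    using arg_min_least[OF finite_steeper assms, of f slope] by (simp add: steeper_def)
qed

lemma height_less_iff_slope_less:
  assumes "fst e = fst f" "X (fst e) < x"
  shows "height e x < height f x \<longleftrightarrow> slope e < slope f"
  using assms by (simp add: height_def)

text \<open>The wedge is nonempty because it contains the nearer of the two right ends.\<close>

lemma apex:
  assumes e: "e \<in> F" and ne: "steeper e \<noteq> {}"
  shows "apex e \<in> wedge e" "\<And>v. v \<in> wedge e \<Longrightarrow> X (apex e) \<le> X v"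
proof -
  note n = next_above[OF ne]
  have fin: "finite (wedge e)" using finite_V by (simp add: wedge_def)
  have less: "height e x < height (next_above e) x" if "X (fst e) < x" for x
    using height_less_iff_slope_less[of e "next_above e"] n that by simp
  have "wedge e \<noteq> {}"
  proof (cases "X (snd e) \<le> X (snd (next_above e))")
    case True
    then have "snd e \<in> wedge e"
      using e snd_in[OF e] left_right[OF e] less[of "X (snd e)"] height_right[OF e]
      by (simp add: wedge_def)
    then show ?thesis by auto
  next
    case False
    then have "snd (next_above e) \<in> wedge e"
      using n snd_in[OF n(1)] left_right[OF n(1)] less[of "X (snd (next_above e))"]
        height_right[OF n(1)] by (simp add: wedge_def)
    then show ?thesis by auto
  qed
  then show "apex e \<in> wedge e" "\<And>v. v \<in> wedge e \<Longrightarrow> X (apex e) \<le> X v"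
    unfolding apex_def using arg_min_if_finite(1)[OF fin] arg_min_least[OF fin] by auto
qed

text \<open>Followed to the left from below or above no boundary of the wedge can be passed. So
  \<open>f\<close> either starts in the wedge, at a vertex left of the apex, or reaches the common
  left end, where it would be an edge between two neighbours in slope.\<close>

lemma no_edge_through_wedge:
  assumes e: "e \<in> F" and ne: "steeper e \<noteq> {}" and f: "f \<in> F"
    and w: "w = apex e" and X: "X (fst f) < X w" "X w \<le> X (snd f)"
    and h: "height e (X w) < height f (X w)" "height f (X w) < height (next_above e) (X w)"
  shows False
proof -
  note n = next_above[OF ne]
  have w_in: "w \<in> wedge e" using apex[OF e ne] w by simp
  note wW = w_in[unfolded wedge_def, simplified]
  show False
  proof (cases "X (fst e) < X (fst f)")
    case True
    have "height e (X (fst f)) \<le> Y (fst f)" "Y (fst f) \<le> height (next_above e) (X (fst f))"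
      using order_leftwards(1)[OF e f, of "X (fst f)" "X w"]
        order_leftwards(1)[OF f n(1), of "X (fst f)" "X w"] True X h wW n by auto
    then have "fst f \<in> wedge e"
      using fst_in[OF f] True wW X by (simp add: wedge_def)
    then show False using apex(2)[OF e ne] X w by fastforce
  next
    case False
    let ?x = "X (fst e)"
    \<comment> \<open>Both boundary edges pass through \<open>fst e\<close>, so \<open>f\<close> is
      squeezed to that height.\<close>
    have le: "Y (fst e) \<le> height f ?x" "height f ?x \<le> Y (fst e)"
      using order_leftwards(1)[OF e f, of ?x "X w"]
        order_leftwards(1)[OF f n(1), of ?x "X w"] False X h wW n
        height_fst[of "next_above e"] height_fst[of e] by auto
    have eq: "fst e = fst f"
      using order_leftwards(2)[OF e f, of ?x "X w"] False X h wW le by auto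
    then have "slope e < slope f" "slope f < slope (next_above e)"
      using height_less_iff_slope_less[of e f "X w"]
        height_less_iff_slope_less[of f "next_above e" "X w"] h wW n by auto
    then show False using n(4)[OF f] eq by auto
  qed
qed

lemma slope_inj:
  assumes "e \<in> F" "f \<in> F" "fst e = fst f" "slope e = slope f"
  shows "e = f"
  using same_left_same_height[of e f "X (fst e) + 1"] assms by (simp add: height_def)

text \<open>If the slopes differed, the steeper edge would be a candidate for the upper neighbour of
  the other one, with smaller slope than the neighbour they share.\<close>

lemma next_above_inj:
  assumes "e \<in> F" "f \<in> F" "steeper e \<noteq> {}" "steeper f \<noteq> {}" "next_above e = next_above f"
  shows "e = f"
proof -
  note ne = next_above[OF assms(3)] and nf = next_above[OF assms(4)]
  have "fst e = fst f" using ne nf assms(5) by metis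
  moreover have "slope e = slope f"
    using ne(3) ne(4)[OF assms(2)] nf(3) nf(4)[OF assms(1)] assms(5) calculation
    by (metis linorder_neqE_linordered_idom not_le)
  ultimately show ?thesis using slope_inj assms by blast
qed

text \<open>These are the edges without a wedge; a vertex has at most one steepest edge to the
  right.\<close>

lemma card_maximal_slope: "card {e \<in> F. steeper e = {}} \<le> card V"
proof (rule card_inj_on_le[of fst])
  show "inj_on fst {e \<in> F. steeper e = {}}"
  proof (rule inj_onI, clarsimp simp del: split_paired_All)
    fix a b b' assume *: "(a, b) \<in> F" "(a, b') \<in> F" "steeper (a, b) = {}" "steeper (a, b') = {}"
    then have "slope (a, b) = slope (a, b')" unfolding steeper_def
      by (smt (verit, best) empty_iff fst_conv mem_Collect_eq)
    then show "b = b'" using slope_inj * by fastforce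
  qed
qed (use fst_in finite_V in auto)

text \<open>
  If two wedges have the same apex, then one of their boundary edges would run inside the other wedge,
  to the left of the apex: the lower of the two upper edges if the apex is strictly below both, the higher of
  the two lower edges if it ends both upper edges.
\<close>

lemma card_apex_below:
  "card {e \<in> F. steeper e \<noteq> {} \<and> Y (apex e) < height (next_above e) (X (apex e))} \<le> card V"
  (is "card ?A \<le> _")
proof (rule card_inj_on_le[of apex])
  show "inj_on apex ?A"
  proof (rule inj_onI, rule ccontr)
    fix e f assume e: "e \<in> ?A" and f: "f \<in> ?A" and eq: "apex e = apex f" and neq: "e \<noteq> f"
    define w where "w = apex e"
    let ?e = "next_above e" and ?f = "next_above f"
    have "w \<in> wedge e" "w \<in> wedge f" using apex(1)[of e] apex(1)[of f] e f eq by (auto simp: w_def)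
    note w = this[unfolded wedge_def, simplified]
    note ne = next_above[of e] and nf = next_above[of f]
    have nneq: "?e \<noteq> ?f" using next_above_inj[of e f] neq e f by auto
    consider "height ?e (X w) < height ?f (X w)" | "height ?f (X w) < height ?e (X w)"
      | "height ?e (X w) = height ?f (X w)" by linarith
    then show False
    proof cases
      case 1
      then show False
        using no_edge_through_wedge[of f ?e w] e f eq w ne by (auto simp: w_def)
    next
      case 2
      then show False
        using no_edge_through_wedge[of e ?f w] e f eq w nf by (auto simp: w_def)
    next
      case 3
      \<comment> \<open>The upper edges meet over \<open>X w\<close>, hence at a vertex, which must
        be \<open>w\<close>; this contradicts that \<open>w\<close> is strictly below them.\<close>
      then obtain v where v: "v \<in> {fst ?e, snd ?e} \<inter> {fst ?f, snd ?f}" "X v = X w"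
        using meet_at_vertex[of ?e ?f "X w"] nneq e f w ne nf by auto
      then have "v = w" using X_eqD[of v w] fst_in[of ?e] snd_in[of ?e] e w ne by auto
      moreover have "v \<noteq> fst ?e" using v w ne e by auto
      ultimately have "w = snd ?e" using v by auto
      then show False using height_right[of ?e] ne e by (auto simp: w_def)
    qed
  qed
qed (use apex(1) finite_V in \<open>auto simp: wedge_def\<close>)

lemma card_apex_on:
  "card {e \<in> F. steeper e \<noteq> {} \<and> Y (apex e) = height (next_above e) (X (apex e))} \<le> card V"
  (is "card ?A \<le> _")
proof (rule card_inj_on_le[of apex])
  show "inj_on apex ?A"
  proof (rule inj_onI, rule ccontr)
    fix e f assume e: "e \<in> ?A" and f: "f \<in> ?A" and eq: "apex e = apex f" and neq: "e \<noteq> f"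
    define w where "w = apex e"
    have "w \<in> wedge e" "w \<in> wedge f" using apex(1)[of e] apex(1)[of f] e f eq by (auto simp: w_def)
    note w = this[unfolded wedge_def, simplified]
    have he: "height e (X w) < Y w"
      using e w height_less_iff_slope_less[of e "next_above e" "X w"] next_above[of e]
      by (auto simp: w_def)
    have hf: "height f (X w) < Y w"
      using f w height_less_iff_slope_less[of f "next_above f" "X w"] next_above[of f] eq
      by (auto simp: w_def)
    consider "height e (X w) < height f (X w)" | "height f (X w) < height e (X w)"
      | "height e (X w) = height f (X w)" by linarith
    then show False
    proof cases
      case 1
      then show False
        using no_edge_through_wedge[of e f w] e f eq w hf by (auto simp: w_def)
    next
      case 2
      then show False
        using no_edge_through_wedge[of f e w] e f eq w he by (auto simp: w_def)
    next
      case 3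
      \<comment> \<open>Here the lower edges would meet in \<open>w\<close>, which is strictly above
        both.\<close>
      then obtain v where v: "v \<in> {fst e, snd e} \<inter> {fst f, snd f}" "X v = X w"
        using meet_at_vertex[of e f "X w"] neq e f w by auto
      then have "v = w" using X_eqD[of v w] fst_in[of e] snd_in[of e] e w by auto
      moreover have "v \<noteq> fst e" using v w by auto
      ultimately have "w = snd e" using v by auto
      then show False using height_right[of e] e he by auto
    qed
  qed
qed (use apex(1) finite_V in \<open>auto simp: wedge_def\<close>)

theorem card_edges: "card F \<le> 3 * card V"
proof -
  let ?T = "{e \<in> F. steeper e = {}}"
  let ?B = "{e \<in> F. steeper e \<noteq> {} \<and> Y (apex e) < height (next_above e) (X (apex e))}"
  let ?O = "{e \<in> F. steeper e \<noteq> {} \<and> Y (apex e) = height (next_above e) (X (apex e))}"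
  have "F \<subseteq> ?T \<union> ?B \<union> ?O" using apex(1) unfolding wedge_def by force
  then have "card F \<le> card (?T \<union> ?B \<union> ?O)" using finite_F by (intro card_mono) auto
  also have "\<dots> \<le> card ?T + card ?B + card ?O"
    using card_Un_le[of ?T ?B] card_Un_le[of "?T \<union> ?B" ?O] by linarith
  also have "\<dots> \<le> 3 * card V"
    using card_maximal_slope card_apex_below card_apex_on by linarith
  finally show ?thesis .
qed

end

subsection \<open>The crossing lemma\<close>

context plane_coords
begin

lemma crossings_subset: "crossings F \<subseteq> F \<times> F"
  by (auto simp: crossings_def)

text \<open>Removing an edge that takes part in a crossing lowers the number of crossings by at
  least one; once no crossing is left, the linear bound applies.\<close>

lemma card_edges_le_crossings:
  assumes "drawing X Y V F"
  shows "card F \<le> 3 * card V + card (crossings F)"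
  using assms
proof (induction "card F" arbitrary: F rule: less_induct)
  case less
  interpret drawing X Y V F by (fact less.prems)
  have fin: "finite (crossings F)"
    using crossings_subset finite_F finite_subset by blast
  show ?case
  proof (cases "crossings F = {}")
    case True
    then interpret plane_drawing X Y V F by unfold_locales (auto simp: crossings_def)
    show ?thesis using card_edges by simp
  next
    case False
    then obtain e f where ef: "(e, f) \<in> crossings F" by auto
    then have e: "e \<in> F" by (simp add: crossings_def)
    let ?G = "F - {e}"
    have "drawing X Y V ?G"
      using finite_V inj_X F_subset left_right vertex_off_edge by unfold_locales auto
    moreover have "card ?G < card F" using e finite_F by (rule card_Diff1_less[rotated])
    ultimately have "card ?G \<le> 3 * card V + card (crossings ?G)" using less.hyps by blast
    moreover have "card (crossings ?G) < card (crossings F)"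
      using ef by (intro psubset_card_mono[OF fin]) (auto simp: crossings_def)
    moreover have "card F = Suc (card ?G)" using card.remove[OF finite_F e] .
    ultimately show ?thesis by linarith
  qed
qed

end

section \<open>Random sampling of vertices\<close>

text \<open>The probability of \<open>Q\<close> when every element of \<open>A\<close> is kept independently with probability \<open>p\<close>.\<close>

definition sampling_weight :: "real \<Rightarrow> 'a set \<Rightarrow> 'a set \<Rightarrow> real" where
  "sampling_weight p A Q = p ^ card Q * (1 - p) ^ card (A - Q)"

text \<open>Expand the product over \<open>A\<close> of \<open>p + g a\<close>, where
  \<open>g\<close> is \<open>0\<close> on \<open>S\<close> and \<open>1 - p\<close> elsewhere: the
  term of \<open>Q\<close> vanishes unless \<open>Q\<close> contains \<open>S\<close>.\<close>

lemma sum_sampling_weight_superset: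
  assumes "finite A" "S \<subseteq> A"
  shows "(\<Sum>Q\<in>Pow A. if S \<subseteq> Q then sampling_weight p A Q else 0) = p ^ card S"
proof -
  define g where "g = (\<lambda>a. if a \<in> S then 0 else 1 - p)"
  have "p ^ card S = (\<Prod>a\<in>A. if a \<in> S then p else 1)"
    using assms by (simp add: prod.If_cases Int_absorb1)
  also have "\<dots> = (\<Prod>a\<in>A. p + g a)"
    by (intro prod.cong) (auto simp: g_def)
  also have "\<dots> = (\<Sum>Q\<in>Pow A. (\<Prod>a\<in>Q. p) * (\<Prod>a\<in>A - Q. g a))"
    using prod_add[OF assms(1), of "\<lambda>_. p" g] by simp
  also have "\<dots> = (\<Sum>Q\<in>Pow A. if S \<subseteq> Q then sampling_weight p A Q else 0)"
  proof (intro sum.cong refl)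
    fix Q assume Q: "Q \<in> Pow A"
    show "(\<Prod>a\<in>Q. p) * (\<Prod>a\<in>A - Q. g a) = (if S \<subseteq> Q then sampling_weight p A Q else 0)"
    proof (cases "S \<subseteq> Q")
      case True
      then have "(\<Prod>a\<in>A - Q. g a) = (\<Prod>a\<in>A - Q. 1 - p)"
        by (intro prod.cong) (auto simp: g_def)
      then show ?thesis using True by (simp add: sampling_weight_def)
    next
      case False
      then obtain a where "a \<in> S" "a \<notin> Q" by auto
      then have "(\<Prod>a\<in>A - Q. g a) = 0"
        using assms by (intro prod_zero) (auto simp: g_def)
      then show ?thesis using False by simp
    qed
  qed
  finally show ?thesis by simp
qed

text \<open>Linearity of expectation: each object survives with probability
  \<open>p ^ k\<close>.\<close>

lemma sum_sampling_weight_card: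
  assumes "finite A" "finite E" "\<And>e. e \<in> E \<Longrightarrow> g e \<subseteq> A \<and> card (g e) = k"
  shows "(\<Sum>Q\<in>Pow A. sampling_weight p A Q * real (card {e \<in> E. g e \<subseteq> Q})) = p ^ k * real (card E)"
proof -
  have "(\<Sum>Q\<in>Pow A. sampling_weight p A Q * real (card {e \<in> E. g e \<subseteq> Q}))
      = (\<Sum>Q\<in>Pow A. \<Sum>e\<in>E. if g e \<subseteq> Q then sampling_weight p A Q else 0)"
    using assms(2) by (intro sum.cong refl) (simp add: sum.If_cases Collect_conj_eq)
  also have "\<dots> = (\<Sum>e\<in>E. \<Sum>Q\<in>Pow A. if g e \<subseteq> Q then sampling_weight p A Q else 0)"
    by (rule sum.swap)
  also have "\<dots> = (\<Sum>e\<in>E. p ^ k)"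
    using assms(3) by (intro sum.cong) (simp_all add: sum_sampling_weight_superset[OF assms(1)])
  finally show ?thesis by simp
qed

context drawing
begin

definition endpoints :: "'a \<times> 'a \<Rightarrow> 'a set" where
  "endpoints e = {fst e, snd e}"

lemma drawing_induced:
  assumes "Q \<subseteq> V"
  shows "drawing X Y Q {e \<in> F. endpoints e \<subseteq> Q}"
proof
  show "finite Q" using assms finite_V finite_subset by blast
  show "inj_on X Q" using assms inj_X inj_on_subset by blast
qed (use assms left_right vertex_off_edge in \<open>auto simp: endpoints_def\<close>)

text \<open>Average the previous edge bound over the drawings induced on random vertex sets: a
  vertex survives with probability \<open>p\<close>, an edge with \<open>p ^ 2\<close>, a crossing
  with \<open>p ^ 4\<close>.\<close>

lemma sampled_card_edges:
  assumes "0 \<le> p" "p \<le> 1"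
  shows "p ^ 2 * real (card F) \<le> 3 * p * real (card V) + p ^ 4 * real (card (crossings F))"
proof -
  let ?W = "sampling_weight p V"
  let ?F = "\<lambda>Q. {e \<in> F. endpoints e \<subseteq> Q}"
  let ?V = "\<lambda>Q. {v \<in> V. {v} \<subseteq> Q}"
  let ?C = "\<lambda>Q. {c \<in> crossings F. endpoints (fst c) \<union> endpoints (snd c) \<subseteq> Q}"
  have finC: "finite (crossings F)"
    using crossings_subset finite_F finite_subset by blast
  have "?W Q * real (card (?F Q)) \<le> 3 * (?W Q * real (card (?V Q))) + ?W Q * real (card (?C Q))"
    if "Q \<in> Pow V" for Q
  proof -
    have "?V Q = Q" "crossings (?F Q) = ?C Q"
      using that by (auto simp: crossings_def)
    then have "real (card (?F Q)) \<le> 3 * real (card (?V Q)) + real (card (?C Q))"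
      using card_edges_le_crossings[OF drawing_induced[of Q]] that by simp
    moreover have "0 \<le> ?W Q" using assms by (simp add: sampling_weight_def)
    ultimately have "?W Q * real (card (?F Q)) \<le> ?W Q * (3 * real (card (?V Q)) + real (card (?C Q)))"
      by (rule mult_left_mono)
    then show ?thesis by (simp add: algebra_simps)
  qed
  then have "(\<Sum>Q\<in>Pow V. ?W Q * real (card (?F Q)))
     \<le> (\<Sum>Q\<in>Pow V. 3 * (?W Q * real (card (?V Q))) + ?W Q * real (card (?C Q)))"
    by (rule sum_mono)
  also have "\<dots> = 3 * (\<Sum>Q\<in>Pow V. ?W Q * real (card (?V Q))) + (\<Sum>Q\<in>Pow V. ?W Q * real (card (?C Q)))"
    by (simp add: sum.distrib sum_distrib_left)
  also have "(\<Sum>Q\<in>Pow V. ?W Q * real (card (?V Q))) = p ^ 1 * real (card V)"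
    using finite_V by (intro sum_sampling_weight_card) auto
  also have "(\<Sum>Q\<in>Pow V. ?W Q * real (card (?C Q))) = p ^ 4 * real (card (crossings F))"
  proof (intro sum_sampling_weight_card finite_V finC)
    fix c assume "c \<in> crossings F"
    \<comment> \<open>Crossing edges have no common endpoint, so a crossing involves exactly four
      vertices.\<close>
    then have c: "fst c \<in> F" "snd c \<in> F" "endpoints (fst c) \<inter> endpoints (snd c) = {}"
      by (auto simp: crossings_def crossing_def endpoints_def)
    have "card (endpoints e) = 2" if "e \<in> F" for e
      using left_right[OF that] by (auto simp: endpoints_def card_insert_if)
    then have "card (endpoints (fst c) \<union> endpoints (snd c)) = 4"
      using c by (subst card_Un_disjoint) (auto simp: endpoints_def)
    moreover have "endpoints (fst c) \<union> endpoints (snd c) \<subseteq> V"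
      using c fst_in snd_in by (auto simp: endpoints_def)
    ultimately show "endpoints (fst c) \<union> endpoints (snd c) \<subseteq> V \<and>
        card (endpoints (fst c) \<union> endpoints (snd c)) = 4" by simp
  qed
  also have "(\<Sum>Q\<in>Pow V. ?W Q * real (card (?F Q))) = p ^ 2 * real (card F)"
  proof (intro sum_sampling_weight_card finite_V finite_F conjI)
    fix e assume "e \<in> F"
    then show "endpoints e \<subseteq> V" "card (endpoints e) = 2"
      using fst_in snd_in left_right[of e] by (auto simp: endpoints_def card_insert_if)
  qed
  finally show ?thesis by simp
qed

end

section \<open>The drawing given by points and lines\<close>

text \<open>
  The assumption on lines is vacuous for sets on which \<open>X\<close> is constant, so vertical lines are allowed;
  they carry at most one point of \<open>P\<close>.
\<close>

locale line_arrangement = plane_coords X Y for X Y :: "'a \<Rightarrow> real" +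
  fixes P :: "'a set" and L :: "'a set set"
  assumes finite_P: "finite P" and finite_L: "finite L"
    and inj_X: "inj_on X P"
    and on_line: "\<lbrakk>l \<in> L; p \<in> l; q \<in> l; X p \<noteq> X q\<rbrakk> \<Longrightarrow> z \<in> l \<longleftrightarrow> Y z = height (p, q) (X z)"
begin

definition consecutive :: "'a set \<Rightarrow> 'a \<times> 'a \<Rightarrow> bool" where
  "consecutive l e \<longleftrightarrow> fst e \<in> P \<inter> l \<and> snd e \<in> P \<inter> l \<and> X (fst e) < X (snd e) \<and>
    (\<forall>c\<in>P \<inter> l. \<not> (X (fst e) < X c \<and> X c < X (snd e)))"

definition edges :: "('a \<times> 'a) set" where
  "edges = {e. \<exists>l\<in>L. consecutive l e}"

lemma X_eqD: "\<lbrakk>X u = X v; u \<in> P; v \<in> P\<rbrakk> \<Longrightarrow> u = v"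
  using inj_X by (auto dest: inj_onD)

lemma line_unique:
  assumes "l \<in> L" "m \<in> L" "p \<in> l" "q \<in> l" "p \<in> m" "q \<in> m" "X p \<noteq> X q"
  shows "l = m"
  using on_line[of l p q] on_line[of m p q] assms by blast

lemma consecutive_height:
  assumes "l \<in> L" "consecutive l e"
  shows "z \<in> l \<longleftrightarrow> Y z = height e (X z)"
  using on_line[of l "fst e" "snd e" z] assms by (auto simp: consecutive_def)

lemma height_same_line:
  assumes "l \<in> L" "consecutive l e" "consecutive l f"
  shows "height e x = height f x"
proof (rule height_eq_imp_height_eq[of _ "X (fst f)" _ "X (snd f)"])
  note e = consecutive_height[OF assms(1,2)]
  show "height e (X (fst f)) = height f (X (fst f))"
    using e[of "fst f"] assms by (auto simp: consecutive_def)
  show "height e (X (snd f)) = height f (X (snd f))"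
    using e[of "snd f"] height_snd[of f] assms by (auto simp: consecutive_def)
  show "X (fst f) \<noteq> X (snd f)" using assms by (auto simp: consecutive_def)
qed

text \<open>A point of \<open>P\<close> inside an edge would lie on its line, between two
  consecutive points.\<close>

sublocale drawing X Y P edges
proof
  fix e v assume "e \<in> edges" "v \<in> P" "X (fst e) < X v" "X v < X (snd e)"
  then show "Y v \<noteq> height e (X v)"
  proof -
    obtain l where "l \<in> L" "consecutive l e" using \<open>e \<in> edges\<close> by (auto simp: edges_def)
    then show ?thesis
      using consecutive_height[of l e v] \<open>v \<in> P\<close> \<open>X (fst e) < X v\<close> \<open>X v < X (snd e)\<close>
      by (auto simp: consecutive_def)
  qed
qed (use finite_P inj_X in \<open>auto simp: edges_def consecutive_def\<close>)

lemma consecutive_same_line_cases: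
  assumes "consecutive l e" "consecutive l f"
  obtains "e = f" | "X (snd e) \<le> X (fst f)" | "X (snd f) \<le> X (fst e)"
proof -
  have "e = f" if "X (fst f) < X (snd e)" "X (fst e) < X (snd f)"
  proof -
    have "\<not> X (fst e) < X (fst f)" "\<not> X (fst f) < X (fst e)"
      "\<not> X (snd e) < X (snd f)" "\<not> X (snd f) < X (snd e)"
      using assms that by (auto simp: consecutive_def)
    then have "X (fst e) = X (fst f)" "X (snd e) = X (snd f)" by simp_all
    then show ?thesis using assms X_eqD by (simp add: consecutive_def prod_eq_iff)
  qed
  then show thesis using that by fastforce
qed

lemma crossing_lines_distinct:
  assumes "consecutive l e" "consecutive m f" "crossing e f"
  shows "l \<noteq> m"
proof
  assume "l = m"
  with assms(2) have f: "consecutive l f" by simp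
  consider "e = f" | "X (snd e) \<le> X (fst f)" | "X (snd f) \<le> X (fst e)"
    using consecutive_same_line_cases[OF assms(1) f] .
  then show False
  proof cases
    case 2
    then have "snd e = fst f"
      using assms by (intro X_eqD) (auto simp: crossing_def consecutive_def)
    then show False using assms by (simp add: crossing_def)
  next
    case 3
    then have "snd f = fst e"
      using assms by (intro X_eqD) (auto simp: crossing_def consecutive_def)
    then show False using assms by (simp add: crossing_def)
  qed (use assms in \<open>auto simp: crossing_def\<close>)
qed

text \<open>Distinct lines meet over one abscissa only, so \<open>x = y\<close>. It is not that of
  an end of \<open>e\<close>: such an end would be a point of \<open>P\<close> on \<open>m\<close>
  within the range of \<open>f\<close>, hence an end of \<open>f\<close>. So only one edge of
  \<open>l\<close> covers it.\<close>

lemma crossing_determined_fst: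
  assumes l: "l \<in> L" "consecutive l e" "consecutive l e'"
    and m: "m \<in> L" "consecutive m f" "consecutive m f'"
    and cr: "crossing e f" "crossing e' f'"
  shows "e = e'"
proof -
  obtain x where x: "X (fst e) \<le> x" "x \<le> X (snd e)" "X (fst f) \<le> x" "x \<le> X (snd f)"
    "height e x = height f x" using cr(1) by (auto simp: crossing_def)
  obtain y where y: "X (fst e') \<le> y" "y \<le> X (snd e')" "X (fst f') \<le> y" "y \<le> X (snd f')"
    "height e' y = height f' y" using cr(2) by (auto simp: crossing_def)
  have "l \<noteq> m" using crossing_lines_distinct l m cr by blast
  have y': "height e y = height f y"
    using y(5) height_same_line[OF l(1) l(2,3)] height_same_line[OF m(1) m(2,3)] by simp
  have "x = y"
  proof (rule ccontr)
    assume "x \<noteq> y"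
    then have "z \<in> l \<longleftrightarrow> z \<in> m" for z
      using height_eq_imp_height_eq[OF x(5) y'] consecutive_height l m by simp
    then show False using \<open>l \<noteq> m\<close> by auto
  qed
  have off: "x \<noteq> X v" if "v \<in> {fst e, snd e}" for v
  proof
    assume v: "x = X v"
    have vl: "v \<in> l" "v \<in> P" using that l by (auto simp: consecutive_def)
    then have "v \<in> m"
      using v x(5) consecutive_height[OF l(1,2), of v] consecutive_height[OF m(1,2), of v] by simp
    then have "X v = X (fst f) \<or> X v = X (snd f)"
      using m(2) vl v x by (force simp: consecutive_def)
    then have "v = fst f \<or> v = snd f" using X_eqD vl m(2) by (auto simp: consecutive_def)
    then show False using that cr(1) by (auto simp: crossing_def)
  qed
  from l(2,3) show "e = e'"
    by (cases rule: consecutive_same_line_cases) (use off x y \<open>x = y\<close> in fastforce)+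
qed

lemma crossing_sym: "crossing e f \<Longrightarrow> crossing f e"
  unfolding crossing_def by (subst Int_commute) fastforce

text \<open>A crossing is determined by the ordered pair of lines carrying its edges.\<close>

lemma card_crossings: "card (crossings edges) \<le> card L ^ 2"
proof -
  define line where "line = (\<lambda>e. SOME l. l \<in> L \<and> consecutive l e)"
  have line: "line e \<in> L \<and> consecutive (line e) e" if "e \<in> edges" for e
    using that someI_ex[of "\<lambda>l. l \<in> L \<and> consecutive l e"] unfolding line_def edges_def by blast
  have "card (crossings edges) \<le> card (L \<times> L)"
  proof (rule card_inj_on_le[of "map_prod line line"])
    show "inj_on (map_prod line line) (crossings edges)"
    proof (rule inj_onI)
      fix c d assume "c \<in> crossings edges" "d \<in> crossings edges"
        and eq: "map_prod line line c = map_prod line line d"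
      then have c: "fst c \<in> edges" "snd c \<in> edges" "crossing (fst c) (snd c)"
        and d: "fst d \<in> edges" "snd d \<in> edges" "crossing (fst d) (snd d)"
        by (auto simp: crossings_def)
      have eq': "line (fst c) = line (fst d)" "line (snd c) = line (snd d)"
        using eq by (simp_all add: map_prod_def case_prod_beta)
      note lc = line[OF c(1)] line[OF c(2)] line[OF d(1)] line[OF d(2)]
      have "fst c = fst d"
        using crossing_determined_fst[of "line (fst c)" "fst c" "fst d" "line (snd c)" "snd c" "snd d"]
          lc eq' c d by metis
      moreover have "snd c = snd d"
        using crossing_determined_fst[of "line (snd c)" "snd c" "snd d" "line (fst c)" "fst c" "fst d"]
          lc eq' c d crossing_sym by metis
      ultimately show "c = d" by (simp add: prod_eq_iff)
    qed
    show "map_prod line line ` crossings edges \<subseteq> L \<times> L"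
      using line by (fastforce simp: crossings_def)
  qed (use finite_L in simp)
  then show ?thesis by (simp add: card_cartesian_product power2_eq_square)
qed

text \<open>Send an incidence to the edge from the point to the next one on the line. Only the
  rightmost point of each line has no such edge.\<close>

lemma card_incidences_le_edges:
  "card {(p, l). p \<in> P \<and> l \<in> L \<and> p \<in> l} \<le> card edges + card L"
proof -
  let ?I = "{(p, l). p \<in> P \<and> l \<in> L \<and> p \<in> l}"
  define right where "right = (\<lambda>(p, l). {q \<in> P. q \<in> l \<and> X p < X q})"
  define next_point where "next_point = (\<lambda>i. arg_min_on X (right i))"
  have fin: "finite (right i)" for i
    using finite_P by (cases i) (simp add: right_def)
  have finI: "finite ?I" by (rule finite_subset[of _ "P \<times> L"]) (use finite_P finite_L in auto)
  have cons: "consecutive l (p, next_point (p, l))"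
    if "(p, l) \<in> ?I" "right (p, l) \<noteq> {}" for p l
  proof -
    have "next_point (p, l) \<in> right (p, l)"
      unfolding next_point_def using arg_min_if_finite(1)[OF fin that(2)] .
    moreover have "X (next_point (p, l)) \<le> X q" if "q \<in> right (p, l)" for q
      unfolding next_point_def using arg_min_least[OF fin _ that] that by auto
    ultimately show ?thesis using that(1) by (force simp: consecutive_def right_def)
  qed
  have "card {i \<in> ?I. right i \<noteq> {}} \<le> card edges"
  proof (rule card_inj_on_le[of "\<lambda>i. (fst i, next_point i)"])
    show "inj_on (\<lambda>i. (fst i, next_point i)) {i \<in> ?I. right i \<noteq> {}}"
    proof (rule inj_onI)
      fix i j assume ij: "i \<in> {i \<in> ?I. right i \<noteq> {}}" "j \<in> {i \<in> ?I. right i \<noteq> {}}"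
        and eq: "(fst i, next_point i) = (fst j, next_point j)"
      have "consecutive (snd i) (fst i, next_point i)" "consecutive (snd j) (fst i, next_point i)"
        using cons[of "fst i" "snd i"] cons[of "fst j" "snd j"] ij eq by auto
      then have "snd i = snd j"
        using line_unique[of "snd i" "snd j" "fst i" "next_point i"] ij
        by (auto simp: consecutive_def)
      then show "i = j" using eq by (simp add: prod_eq_iff)
    qed
    show "(\<lambda>i. (fst i, next_point i)) ` {i \<in> ?I. right i \<noteq> {}} \<subseteq> edges"
    proof (rule image_subsetI)
      fix i assume "i \<in> {i \<in> ?I. right i \<noteq> {}}"
      then show "(fst i, next_point i) \<in> edges"
        using cons[of "fst i" "snd i"] by (auto simp: edges_def)
    qed
  qed (rule finite_F)
  moreover have "card {i \<in> ?I. right i = {}} \<le> card L"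
  proof (rule card_inj_on_le[of snd])
    show "inj_on snd {i \<in> ?I. right i = {}}"
    proof (rule inj_onI, clarsimp)
      fix p q l assume "p \<in> P" "q \<in> P" "p \<in> l" "q \<in> l" "right (p, l) = {}" "right (q, l) = {}"
      then have "X p = X q" unfolding right_def by fastforce
      then show "p = q" using X_eqD \<open>p \<in> P\<close> \<open>q \<in> P\<close> by blast
    qed
  qed (use finite_L in auto)
  moreover have "card ?I = card {i \<in> ?I. right i \<noteq> {}} + card {i \<in> ?I. right i = {}}"
    using finI by (subst card_Un_disjoint[symmetric]) (auto intro: arg_cong[of _ _ card])
  ultimately show ?thesis by linarith
qed

text \<open>This is the sampled bound divided by \<open>p ^ 2\<close>. Leaving \<open>p\<close> free
  lets each application balance the last two terms itself.\<close>

theorem card_incidences_le: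
  assumes "0 < p" "p \<le> 1"
  shows "real (card {(p, l). p \<in> P \<and> l \<in> L \<and> p \<in> l})
    \<le> real (card L) + 3 * real (card P) / p + p ^ 2 * real (card L) ^ 2"
proof -
  have "real (card (crossings edges)) \<le> real (card L) ^ 2"
    using card_crossings by (metis of_nat_le_iff of_nat_power)
  then have "p ^ 4 * real (card (crossings edges)) \<le> p ^ 4 * real (card L) ^ 2"
    by (intro mult_left_mono) auto
  then have "p ^ 2 * real (card edges) \<le> 3 * p * real (card P) + p ^ 4 * real (card L) ^ 2"
    using sampled_card_edges[of p] assms by linarith
  also have "\<dots> = p ^ 2 * (3 * real (card P) / p + p ^ 2 * real (card L) ^ 2)"
    using assms by (simp add: distrib_left power2_eq_square power4_eq_xxxx)
  finally have "real (card edges) \<le> 3 * real (card P) / p + p ^ 2 * real (card L) ^ 2"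
    using assms by simp
  then show ?thesis using card_incidences_le_edges by linarith
qed

end

subsection \<open>Incidences in the plane\<close>

text \<open>Each pair of points with different second coordinates excludes a single value of
  \<epsilon>; pairs with equal second coordinates are separated by the first.\<close>

lemma exists_injective_shear:
  fixes P :: "(real ^ 2) set"
  assumes "finite P"
  obtains \<epsilon> where "inj_on (\<lambda>v. v $ 1 + \<epsilon> * v $ 2) P"
proof -
  have "finite ((\<lambda>(u, v). (v $ 1 - u $ 1) / (u $ 2 - v $ 2)) ` (P \<times> P))"
    using assms by simp
  then obtain \<epsilon> where \<epsilon>: "\<epsilon> \<notin> (\<lambda>(u, v). (v $ 1 - u $ 1) / (u $ 2 - v $ 2)) ` (P \<times> P)"
    using ex_new_if_finite[OF infinite_UNIV_char_0] by blast
  have "inj_on (\<lambda>v. v $ 1 + \<epsilon> * v $ 2) P"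
  proof (rule inj_onI)
    fix u v assume uv: "u \<in> P" "v \<in> P" and eq: "u $ 1 + \<epsilon> * u $ 2 = v $ 1 + \<epsilon> * v $ 2"
    have "u $ 2 = v $ 2"
    proof (rule ccontr)
      assume "u $ 2 \<noteq> v $ 2"
      then have "\<epsilon> = (v $ 1 - u $ 1) / (u $ 2 - v $ 2)"
        using eq by (simp add: eq_divide_eq algebra_simps)
      then show False using \<epsilon> uv by force
    qed
    then show "u = v" using eq by (simp add: vec_eq_iff forall_2)
  qed
  then show thesis using that by blast
qed

lemma line_eq_affine_hull:
  assumes "is_line l" "p \<in> l" "q \<in> l" "p \<noteq> q"
  shows "l = affine hull {p, q}"
proof (rule affine_dim_equal[symmetric])
  show "affine hull {p, q} \<subseteq> l"
    using assms by (simp add: is_line_def hull_minimal)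
qed (use assms in \<open>auto simp: is_line_def aff_dim_affine_hull\<close>)

lemma szemeredi_trotter:
  fixes P :: "(real ^ 2) set"
  assumes fin: "finite P" "finite L" and lines: "\<And>l. l \<in> L \<Longrightarrow> is_line l" and p: "0 < p" "p \<le> 1"
  shows "real (incidences P L) \<le> real (card L) + 3 * real (card P) / p + p ^ 2 * real (card L) ^ 2"
proof -
  obtain \<epsilon> where inj: "inj_on (\<lambda>v. v $ 1 + \<epsilon> * v $ 2) P"
    using exists_injective_shear[OF fin(1)] .
  define X Y :: "real ^ 2 \<Rightarrow> real" where "X = (\<lambda>v. v $ 1 + \<epsilon> * v $ 2)" and "Y = (\<lambda>v. v $ 2)"
  interpret plane_coords X Y .
  interpret line_arrangement X Y P L
  proof
    show "inj_on X P" using inj by (simp add: X_def)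
    fix l u v z assume l: "l \<in> L" "u \<in> l" "v \<in> l" "X u \<noteq> X v"
    have hull: "l = {a *\<^sub>R u + b *\<^sub>R v | a b. a + b = 1}"
      using line_eq_affine_hull[OF lines[OF l(1)] l(2,3)] l(4) affine_hull_2[of u v] by auto
    have lin: "X (a *\<^sub>R u + b *\<^sub>R v) = a * X u + b * X v" "Y (a *\<^sub>R u + b *\<^sub>R v) = a * Y u + b * Y v" for a b
      by (simp_all add: X_def Y_def algebra_simps)
    show "z \<in> l \<longleftrightarrow> Y z = height (u, v) (X z)"
    proof
      assume "z \<in> l"
      then obtain a b where z: "z = a *\<^sub>R u + b *\<^sub>R v" and "a + b = 1"
        unfolding hull by blast
      then have a: "a = 1 - b" by simp
      have "Y z = Y u + b * (Y v - Y u)" "X z - X u = b * (X v - X u)"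
        unfolding z lin unfolding a by (simp_all add: algebra_simps)
      then show "Y z = height (u, v) (X z)"
        using l(4) by (simp add: height_def slope_def)
    next
      assume z: "Y z = height (u, v) (X z)"
      \<comment> \<open>\<open>b\<close> is the affine parameter of the point of the line with the
        same \<open>X\<close> as \<open>z\<close>; then \<open>Y\<close> agrees too, and
        \<open>X\<close> and \<open>Y\<close> together determine a point.\<close>
      define b where "b = (X z - X u) / (X v - X u)"
      define z' where "z' = (1 - b) *\<^sub>R u + b *\<^sub>R v"
      have "Y z' = Y u + b * (Y v - Y u)" "X z' = X u + b * (X v - X u)"
        unfolding z'_def lin by (simp_all add: algebra_simps)
      moreover have "b * (X v - X u) = X z - X u" using l(4) by (simp add: b_def)
      moreover have "Y z = Y u + b * (Y v - Y u)"
        using z by (simp add: height_def slope_def b_def)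
      ultimately have "Y z = Y z'" "X z = X z'" by simp_all
      then have "z = z'" by (simp add: X_def Y_def vec_eq_iff forall_2)
      then show "z \<in> l" unfolding hull z'_def by force
    qed
  qed (use fin in auto)
  show ?thesis using card_incidences_le[OF p] unfolding incidences_def .
qed

section \<open>From the incidence bound to rich points and lines\<close>

lemma incidences_eq_sum_points:
  assumes "finite P" "finite L"
  shows "incidences P L = (\<Sum>p\<in>P. card {l \<in> L. p \<in> l})"
proof -
  have "{(p, l). p \<in> P \<and> l \<in> L \<and> p \<in> l} = (SIGMA p:P. {l \<in> L. p \<in> l})" by auto
  then show ?thesis using assms by (simp add: incidences_def)
qed

lemma incidences_eq_sum_lines:
  assumes "finite P" "finite L"
  shows "incidences P L = (\<Sum>l\<in>L. card {p \<in> P. p \<in> l})"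
proof -
  have "(\<Sum>p\<in>P. card {l \<in> L. p \<in> l}) = (\<Sum>l\<in>L. card {p \<in> P. p \<in> l})"
    using sum_multicount_gen[of P L "(\<in>)" "\<lambda>l. card {p \<in> P. p \<in> l}"] assms by simp
  then show ?thesis using incidences_eq_sum_points[OF assms] by simp
qed

lemma sum_le_sum_rich:
  fixes f :: "'a \<Rightarrow> nat"
  assumes "finite A" "0 \<le> r"
  shows "real (sum f A) \<le> real (sum f {a \<in> A. r \<le> real (f a)}) + r * real (card A)"
proof -
  have "real (sum f A) \<le> (\<Sum>a\<in>A. (if r \<le> real (f a) then real (f a) else 0) + r)"
    using assms(2) unfolding of_nat_sum by (intro sum_mono) auto
  also have "\<dots> = real (sum f {a \<in> A. r \<le> real (f a)}) + r * real (card A)"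
    using assms(1) by (simp add: sum.distrib sum.inter_filter if_distrib[of real] cong: if_cong)
  finally show ?thesis .
qed

text \<open>Here \<open>a\<close> stands for the cube root of \<open>n\<close>. If rich points were
  few, the incidence bound with sampling probability \<open>t / a\<close> would leave too few
  incidences: \<open>t\<close> keeps the crossing term small, and \<open>d\<close>, chosen after
  \<open>t\<close>, the vertex term.\<close>

lemma many_rich_points:
  fixes P :: "(real ^ 2) set"
  assumes fin: "finite P" "finite L" and lines: "\<And>l. l \<in> L \<Longrightarrow> is_line l"
    and card: "real (card P) = a ^ 3" "real (card L) = a ^ 3"
    and c: "0 < c" and a: "12 / c \<le> a" "1 \<le> a"
    and t: "0 < t" "t \<le> 1" "t \<le> c / 4"
    and d: "0 < d" "d \<le> c / 8" "d \<le> c * t / 12"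
    and inc: "c * a ^ 4 \<le> real (incidences P L)"
  shows "d * a ^ 3 \<le> real (card {p \<in> P. d * a \<le> real (card {l \<in> L. p \<in> l})})"
proof (rule ccontr)
  let ?A = "{p \<in> P. d * a \<le> real (card {l \<in> L. p \<in> l})}"
  assume "\<not> ?thesis"
  then have small: "real (card ?A) \<le> d * a ^ 3" by simp
  have a4: "a ^ 4 = a ^ 3 * a" by (simp add: eval_nat_numeral)
  have a0: "0 < a" using a by simp
  have "3 * real (card ?A) / (t / a) \<le> 3 * (d * a ^ 3) / (t / a)"
    using small a0 t by (intro divide_right_mono) auto
  also have "\<dots> = 3 * d / t * a ^ 4" by (simp add: a4)
  also have "\<dots> \<le> c / 4 * a ^ 4"
    using d(3) t(1) by (intro mult_right_mono) (auto simp: divide_le_eq)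
  finally have 1: "3 * real (card ?A) / (t / a) \<le> c / 4 * a ^ 4" .
  have "t ^ 2 \<le> 1 * (c / 4)" unfolding power2_eq_square using t by (intro mult_mono) auto
  then have "t ^ 2 * a ^ 4 \<le> c / 4 * a ^ 4" by (intro mult_right_mono) auto
  moreover have "(t / a) ^ 2 * (a ^ 3) ^ 2 = t ^ 2 * a ^ 4"
    using a0 by (simp add: eval_nat_numeral)
  ultimately have 2: "(t / a) ^ 2 * (a ^ 3) ^ 2 \<le> c / 4 * a ^ 4" by simp
  have "1 * a ^ 3 \<le> (c / 12 * a) * a ^ 3"
    using a c by (intro mult_right_mono) (auto simp: field_simps)
  then have 3: "a ^ 3 \<le> c / 12 * a ^ 4" by (simp add: a4 mult_ac)
  have 4: "d * a * a ^ 3 \<le> c / 8 * a ^ 4"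
    using d(2) a0 by (simp add: a4)
  have "real (incidences ?A L) \<le> a ^ 3 + 3 * real (card ?A) / (t / a) + (t / a) ^ 2 * (a ^ 3) ^ 2"
    using szemeredi_trotter[of ?A L "t / a"] fin lines a0 a(2) t card(2) by simp
  moreover have "real (incidences P L) \<le> real (incidences ?A L) + d * a * a ^ 3"
    using sum_le_sum_rich[OF fin(1), of "d * a" "\<lambda>p. card {l \<in> L. p \<in> l}"] fin d(1) a0 card(1)
    by (simp add: incidences_eq_sum_points)
  \<comment> \<open>The coefficients add up to \<open>17 / 24\<close> of \<open>c\<close>.\<close>
  ultimately have "real (incidences P L) \<le> (c / 12 + c / 4 + c / 4 + c / 8) * a ^ 4"
    unfolding distrib_right using 1 2 3 4 by linarith
  also have "\<dots> < c * a ^ 4"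
    using c a0 by (intro mult_strict_right_mono) auto
  finally show False using inc by simp
qed

text \<open>Now all points remain and the lines are few, so the probability is \<open>s / a\<close>
  with a large \<open>s\<close> to control the vertex term; the small \<open>d\<close> then controls
  the crossing term.\<close>

lemma many_rich_lines:
  fixes P :: "(real ^ 2) set"
  assumes fin: "finite P" "finite L" and lines: "\<And>l. l \<in> L \<Longrightarrow> is_line l"
    and card: "real (card P) = a ^ 3" "real (card L) = a ^ 3"
    and c: "0 < c" and a: "12 / c \<le> a" "1 \<le> a"
    and d: "0 < d" "d \<le> c / 8" "d \<le> 1" "d \<le> c ^ 3 / 576"
    and inc: "c * a ^ 4 \<le> real (incidences P L)"
  shows "d * a ^ 3 \<le> real (card {l \<in> L. d * a \<le> real (card {p \<in> P. p \<in> l})})"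
proof (rule ccontr)
  let ?B = "{l \<in> L. d * a \<le> real (card {p \<in> P. p \<in> l})}"
  \<comment> \<open>With this value the vertex term is exactly \<open>c / 4 * a ^ 4\<close>, and
    \<open>12 / c \<le> a\<close> makes \<open>s / a\<close> a probability.\<close>
  define s where "s = 12 / c"
  have s0: "0 < s" using c by (simp add: s_def)
  assume "\<not> ?thesis"
  then have small: "real (card ?B) \<le> d * a ^ 3" by simp
  have a4: "a ^ 4 = a ^ 3 * a" by (simp add: eval_nat_numeral)
  have a0: "0 < a" using a by simp
  have 1: "3 * a ^ 3 / (s / a) = c / 4 * a ^ 4"
    using c by (simp add: a4 s_def)
  \<comment> \<open>One factor \<open>d\<close> is bounded by \<open>1\<close>, the other by
    \<open>c ^ 3 / 576\<close>, where \<open>576 = 4 * 12 ^ 2\<close>.\<close>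
  have "s ^ 2 * d ^ 2 \<le> s ^ 2 * (1 * (c ^ 3 / 576))"
    unfolding power2_eq_square[of d] using d by (intro mult_left_mono mult_mono) auto
  also have "\<dots> = c / 4" using c by (simp add: s_def power_divide eval_nat_numeral)
  finally have sd: "s ^ 2 * d ^ 2 \<le> c / 4" .
  have "(s / a) ^ 2 * real (card ?B) ^ 2 \<le> (s / a) ^ 2 * (d * a ^ 3) ^ 2"
    using small by (intro mult_left_mono power_mono) auto
  also have "\<dots> = s ^ 2 * d ^ 2 * a ^ 4"
    using a0 by (simp add: eval_nat_numeral)
  also have "\<dots> \<le> c / 4 * a ^ 4" using sd by (intro mult_right_mono) auto
  finally have 2: "(s / a) ^ 2 * real (card ?B) ^ 2 \<le> c / 4 * a ^ 4" .
  have "1 * a ^ 3 \<le> (c / 12 * a) * a ^ 3"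
    using a c by (intro mult_right_mono) (auto simp: field_simps)
  moreover have "d * a ^ 3 \<le> 1 * a ^ 3" using d a0 by (intro mult_right_mono) auto
  ultimately have 3: "real (card ?B) \<le> c / 12 * a ^ 4" using small by (simp add: a4 mult_ac)
  have 4: "d * a * a ^ 3 \<le> c / 8 * a ^ 4"
    using d(2) a0 by (simp add: a4)
  have "real (incidences P ?B) \<le> real (card ?B) + 3 * a ^ 3 / (s / a) + (s / a) ^ 2 * real (card ?B) ^ 2"
  proof -
    have "0 < s / a" "s / a \<le> 1" using s0 a0 a(1)[folded s_def] by simp_all
    then show ?thesis using szemeredi_trotter[of P ?B "s / a"] fin lines unfolding card(1) by simp
  qed
  moreover have "real (incidences P L) \<le> real (incidences P ?B) + d * a * a ^ 3"
    using sum_le_sum_rich[OF fin(2), of "d * a" "\<lambda>l. card {p \<in> P. p \<in> l}"] fin d(1) a0 card(2)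
    by (simp add: incidences_eq_sum_lines)
  ultimately have "real (incidences P L) \<le> (c / 12 + c / 4 + c / 4 + c / 8) * a ^ 4"
    unfolding distrib_right using 1 2 3 4 by linarith
  also have "\<dots> < c * a ^ 4"
    using c a0 by (intro mult_strict_right_mono) auto
  finally show False using inc by simp
qed

theorem proposition4p3:
  fixes c :: real
  assumes "c > 0"
  shows "\<exists>c' > (0::real). \<exists>n\<^sub>0 :: nat. \<forall>n \<ge> n\<^sub>0. \<forall>(P :: (real ^ 2) set) (L :: (real ^ 2) set set).
    finite P \<longrightarrow> card P = n \<longrightarrow> finite L \<longrightarrow> card L = n \<longrightarrow> (\<forall>l\<in>L. is_line l) \<longrightarrow>
    real (incidences P L) \<ge> c * real n powr (4/3) \<longrightarrow>
      real (card {p \<in> P. real (card {l \<in> L. p \<in> l}) \<ge> c' * real n powr (1/3)}) \<ge> c' * real n \<and>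
      real (card {l \<in> L. real (card {p \<in> P. p \<in> l}) \<ge> c' * real n powr (1/3)}) \<ge> c' * real n"
proof -
  define t where "t = min 1 (c / 4)"
  define d where "d = Min {1, c / 8, c * t / 12, c ^ 3 / 576}"
  have t: "0 < t" "t \<le> 1" "t \<le> c / 4" using assms by (auto simp: t_def)
  have d: "0 < d" "d \<le> 1" "d \<le> c / 8" "d \<le> c * t / 12" "d \<le> c ^ 3 / 576"
    using assms t by (auto simp: d_def)
  \<comment> \<open>This makes \<open>n\<close> positive and its cube root at least
    \<open>12 / c\<close>.\<close>
  define n\<^sub>0 where "n\<^sub>0 = max 1 (nat \<lceil>(12 / c) ^ 3\<rceil>)"
  show ?thesis
  proof (intro exI[of _ d] exI[of _ n\<^sub>0] conjI allI impI d(1))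
    fix n :: nat and P :: "(real ^ 2) set" and L :: "(real ^ 2) set set"
    assume n: "n\<^sub>0 \<le> n" and fin: "finite P" "finite L" and card: "card P = n" "card L = n"
      and lines: "\<forall>l\<in>L. is_line l" and inc: "c * real n powr (4/3) \<le> real (incidences P L)"
    define a where "a = real n powr (1/3)"
    have n1: "1 \<le> n" and n2: "(12 / c) ^ 3 \<le> real n" using n by (simp_all add: n\<^sub>0_def)
    have a3: "a ^ 3 = real n" and a4: "a ^ 4 = real n powr (4/3)"
      using n1 by (simp_all add: a_def powr_powr flip: powr_realpow)
    have a1: "1 \<le> a" using n1 by (simp add: a_def ge_one_powr_ge_zero)
    have ac: "12 / c \<le> a" by (rule power_le_imp_le_base[of _ 2]) (use n2 a3 a1 in auto)
    have inc': "c * a ^ 4 \<le> real (incidences P L)" using inc a4 by simp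
    show "d * real n \<le> real (card {p \<in> P. d * real n powr (1/3) \<le> real (card {l \<in> L. p \<in> l})})"
      using many_rich_points[OF fin _ _ _ assms ac a1 t d(1,3,4) inc'] lines card a3
      by (simp add: a_def)
    show "d * real n \<le> real (card {l \<in> L. d * real n powr (1/3) \<le> real (card {p \<in> P. p \<in> l})})"
      using many_rich_lines[OF fin _ _ _ assms ac a1 d(1,3,2,5) inc'] lines card a3
      by (simp add: a_def)
  qed
qed

end
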